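(* Let $q>1$ be an odd integer and let $R$ be an integral ring not isomorphic to $\mathbb{F}_3$ and having characteristic different from $2$. Then the following two conditions are equivalent, where in (1) one may read either "for every $n\in\mathbb{N}$" or "for some $n\in\mathbb{N}$" (both resulting statements being equivalent to (2)): (1) For every (for some) $n\in\mathbb{N}$, the ring $\mathbb{M}_n(R)$ is $(q-1)$-torsion clean. (2) $R$ is a finite field and $|R|=q$.
   Context: $\mathbb{N}$ is the set of positive integers. An integral ring is a non-zero commutative ring with $1$ having no non-trivial zero divisors. $\mathbb{M}_n(R)$ is the ring of $n\times n$ matrices over $R$, and $\mathbb{F}_3$ is the field with $3$ elements. For $m\in\mathbb{N}$, an $m$-torsion clean decomposition of an element $r$ of a ring $S$ is an expression $r=e+u$ with $e,u\in S$, $e^2=e$, $u$ a unit and $u^m=1$. The ring $S$ is $m$-torsion clean if every element of $S$ has an $m$-torsion clean decomposition and $m$ is the minimal natural number with this property. *)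

theory Defs
  imports
    "Jordan_Normal_Form.Matrix"
    "Jordan_Normal_Form.VS_Connect"
    "HOL-Algebra.QuotRing"
    "HOL-Number_Theory.Residues"
    "HOL-Library.Cardinality"
begin

definition torsion_clean_decomposition ::
    "('a, 'b) ring_scheme \<Rightarrow> nat \<Rightarrow> 'a \<Rightarrow> 'a \<Rightarrow> 'a \<Rightarrow> bool" where
  "torsion_clean_decomposition S m r e u \<longleftrightarrow>
     e \<in> carrier S \<and> u \<in> Units S \<and>
     e [^]\<^bsub>S\<^esub> (2::nat) = e \<and> u [^]\<^bsub>S\<^esub> m = \<one>\<^bsub>S\<^esub> \<and>
     r = e \<oplus>\<^bsub>S\<^esub> u"

definition all_torsion_clean :: "('a, 'b) ring_scheme \<Rightarrow> nat \<Rightarrow> bool" where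
  "all_torsion_clean S m \<longleftrightarrow>
     (\<forall>r \<in> carrier S. \<exists>e u. torsion_clean_decomposition S m r e u)"

text \<open>The exponent is required to be positive: for exponent 0 the condition on the unit
  would be vacuous.\<close>

definition torsion_clean :: "('a, 'b) ring_scheme \<Rightarrow> nat \<Rightarrow> bool" where
  "torsion_clean S m \<longleftrightarrow>
     m > 0 \<and> all_torsion_clean S m \<and> (\<forall>k. 0 < k \<and> all_torsion_clean S k \<longrightarrow> m \<le> k)"

end

theory Submission
  imports
    Defs
    "HOL-Computational_Algebra.Polynomial_Factorial"
    "HOL-Library.Function_Algebras"
    "Subresultants.More_Homomorphisms"
begin

text \<open>
  Write \<open>m\<close>-clean for: every element is the sum of an idempotent and a unit whose \<open>m\<close>-th power is \<open>1\<close>.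
  Both halves of the equivalence come from the fact that the order of \<open>R\<close> can be read off from the
  exponents \<open>m\<close> for which the matrix ring is \<open>m\<close>-clean.

  \<^bold>\<open>Lower bound.\<close> Let a scalar matrix \<open>r I\<close> be \<open>e + u\<close> with \<open>e\<close> idempotent and \<open>u\<^sup>k = 1\<close>. Then \<open>u\<close>
  acts as \<open>r\<close> on the kernel of \<open>e\<close> and as \<open>r - 1\<close> on its image, so \<open>r\<^sup>k = 1\<close> or \<open>(r - 1)\<^sup>k = 1\<close>
  (\<open>scalar_matrix_clean\<close>). Hence \<open>R\<close> is covered by the set \<open>G\<close> of \<open>k\<close>-th roots of unity and its
  translate \<open>1 + G\<close>. So \<open>R\<close> is finite, and \<open>G\<close> fills more than half of the nonzero elements; being
  a group, it contains all of them. As \<open>G\<close> has at most \<open>k\<close> elements, \<open>|R| - 1 \<le> k\<close>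
  (\<open>torsion_exponent_bound\<close>).

  \<^bold>\<open>The bound is attained.\<close> Let \<open>F\<close> be a finite field with at least four elements in which
  \<open>2 \<noteq> 0\<close>, and put \<open>m = |F| - 1\<close>. It must be shown that every endomorphism \<open>T\<close> of a finite vector
  space is \<open>e + u\<close> with \<open>e\<close> idempotent and \<open>u\<^sup>m = 1\<close>. Since every nonzero element of \<open>F\<close> is an \<open>m\<close>-th root of
  unity, it is enough that \<open>u\<close> is diagonalisable with nonzero eigenvalues. This property passes to
  direct sums (\<open>clean_on_direct_sum\<close>), and a vector whose annihilating polynomials annihilate the
  whole space (\<open>vector_with_minimal_annihilator\<close>) spans a cyclic subspace with an invariant complement
  (\<open>krylov_complement\<close>). So only a cyclic space of dimension \<open>n + 1\<close> is left.

  There the vectors \<open>b\<^sub>0 = v\<close>, \<open>b\<^sub>i\<^sub>+\<^sub>1 = (T - \<delta>\<^sub>i) b\<^sub>i\<close> form a basis for every choice of scalars \<open>\<delta>\<^sub>i\<close>,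
  and if these sum to the trace of \<open>T\<close>, the matrix of \<open>T\<close> has diagonal \<open>\<delta>\<close>, ones below the diagonal, and
  otherwise only entries in the last column, above the diagonal. Write \<open>\<delta>\<^sub>i = \<epsilon>\<^sub>i + \<mu>\<^sub>i\<close> and give
  the ones below the diagonal alternately to \<open>e\<close> and \<open>u\<close>, the last one to \<open>e\<close>. Both summands then
  consist of blocks of size at most two, except that \<open>u\<close> also receives the last column. The block of
  \<open>e\<close> with diagonal \<open>(\<epsilon>\<^sub>i, \<epsilon>\<^sub>i\<^sub>+\<^sub>1)\<close> is idempotent if that diagonal is \<open>(0, 1)\<close> or \<open>(1, 0)\<close>; the block of \<open>u\<close> with diagonal
  \<open>(\<mu>\<^sub>i, \<mu>\<^sub>i\<^sub>+\<^sub>1)\<close> is diagonalisable if \<open>\<mu>\<^sub>i \<noteq> \<mu>\<^sub>i\<^sub>+\<^sub>1\<close>; and the last column does no harm as long as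
  \<open>\<mu>\<^sub>n\<close> differs from all the other \<open>\<mu>\<^sub>i\<close> (\<open>clean_on_cyclic\<close>). That such \<open>\<epsilon>\<close> and \<open>\<mu>\<close> exist with the prescribed
  sum is where \<open>|F| \<ge> 4\<close> and \<open>2 \<noteq> 0\<close> enter (\<open>diagonal_choice\<close>).

  An integral ring with \<open>2 \<noteq> 0\<close> that is not the field with three elements has at least four elements, so the two
  parts show that the least exponent is \<open>|R| - 1\<close> for every positive matrix size if \<open>R\<close> is finite,
  and that there is no exponent if \<open>R\<close> is infinite.
\<close>

section \<open>Polynomials acting through an endomorphism\<close>

locale endomorphism = vector_space scale
  for scale :: "'a::field \<Rightarrow> 'v::ab_group_add \<Rightarrow> 'v" (infixr \<open>*s\<close> 75) +
  fixes T :: "'v \<Rightarrow> 'v"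
  assumes linear_T: "Vector_Spaces.linear scale scale T"
begin

sublocale T: Vector_Spaces.linear scale scale T by (rule linear_T)

text \<open>
  This is \<open>p(T) v\<close>, in the Horner form that lets the algebraic laws follow by induction on
  the polynomial.
\<close>

definition poly_action :: "'a poly \<Rightarrow> 'v \<Rightarrow> 'v" where
  "poly_action p v = fold_coeffs (\<lambda>a w. a *s v + T w) p 0"

lemma poly_action_0 [simp]: "poly_action 0 v = 0"
  by (simp add: poly_action_def)

lemma poly_action_pCons [simp]: "poly_action (pCons a p) v = a *s v + T (poly_action p v)"
  by (cases "a = 0 \<and> p = 0") (auto simp: poly_action_def)

lemma poly_action_1 [simp]: "poly_action 1 v = v"
  unfolding one_pCons poly_action_pCons by simp

lemma poly_action_add: "poly_action (p + q) v = poly_action p v + poly_action q v"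
  by (induction p q rule: poly_induct2) (simp_all add: T.add scale_left_distrib)

lemma poly_action_smult: "poly_action (Polynomial.smult c p) v = c *s poly_action p v"
  by (induction p) (simp_all add: T.scale scale_right_distrib)

lemma poly_action_diff: "poly_action (p - q) v = poly_action p v - poly_action q v"
  using poly_action_add[of "p - q" q v] by (simp add: algebra_simps)

lemma poly_action_mult: "poly_action (p * q) v = poly_action p (poly_action q v)"
  by (induction p) (simp_all add: poly_action_add poly_action_smult)

lemma poly_action_monom: "poly_action (Polynomial.monom c i) v = c *s (T ^^ i) v"
  by (induction i) (simp_all add: monom_0 monom_Suc T.scale)

lemma linear_poly_action: "Vector_Spaces.linear scale scale (poly_action p)"
proof -
  have "poly_action p (x + y) = poly_action p x + poly_action p y" for x y
    by (induction p) (simp_all add: T.add scale_right_distrib algebra_simps)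
  moreover have "poly_action p (c *s x) = c *s poly_action p x" for c x
    by (induction p) (simp_all add: T.scale scale_right_distrib scale_left_commute)
  ultimately show ?thesis
    by (simp add: Vector_Spaces.linear_iff vector_space_axioms)
qed

sublocale poly_action: Vector_Spaces.linear scale scale "poly_action p" for p by (rule linear_poly_action)

lemma poly_action_dvd: "g dvd p \<Longrightarrow> poly_action g v = 0 \<Longrightarrow> poly_action p v = 0"
  unfolding dvd_def by (auto simp: poly_action_mult mult.commute[of g])

end

section \<open>A vector with the smallest possible annihilator\<close>

text \<open>
  Only subspaces of finite cardinality occur. Finiteness then replaces every argument about
  dimension: orbits of \<open>T\<close> repeat, and the inductions run over the number of elements.
\<close>

locale finite_invariant_subspace = endomorphism +
  fixes S :: "'b set"
  assumes finite_S: "finite S" and subspace_S: "subspace S" and T_in_S: "x \<in> S \<Longrightarrow> T x \<in> S"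
begin

lemma poly_action_in_S: "v \<in> S \<Longrightarrow> poly_action p v \<in> S"
  by (induction p) (auto intro: subspace_0 subspace_add subspace_scale T_in_S subspace_S)

lemma funpow_in_S: "v \<in> S \<Longrightarrow> (T ^^ i) v \<in> S"
  by (induction i) (auto intro: T_in_S)

text \<open>
  The orbit of \<open>v\<close> repeats, so some \<open>X\<^sup>i - X\<^sup>j\<close> annihilates \<open>v\<close>; division with remainder by an
  annihilating polynomial of least degree does the rest.
\<close>

lemma annihilator_generator:
  assumes "v \<in> S"
  obtains g where "g \<noteq> 0" "\<And>p. poly_action p v = 0 \<longleftrightarrow> g dvd p"
proof -
  have "\<not> inj (\<lambda>i. (T ^^ i) v)"
    using finite_S funpow_in_S[OF assms] by (meson finite_imageD finite_subset image_subsetI infinite_UNIV_nat)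
  then obtain i j where "i \<noteq> j" "(T ^^ i) v = (T ^^ j) v"
    by (auto simp: inj_def)
  then have "Polynomial.monom 1 i - Polynomial.monom 1 j \<noteq> (0 :: 'a poly)" "poly_action (Polynomial.monom 1 i - Polynomial.monom 1 j) v = 0"
    by (auto simp: poly_action_diff poly_action_monom monom_eq_iff')
  then obtain g where g: "g \<noteq> 0" "poly_action g v = 0"
    and least: "\<And>p. p \<noteq> 0 \<Longrightarrow> poly_action p v = 0 \<Longrightarrow> degree g \<le> degree p"
    using ex_has_least_nat[of "\<lambda>p. p \<noteq> 0 \<and> poly_action p v = 0" "Polynomial.monom 1 i - Polynomial.monom 1 j" degree] by blast
  have "g dvd p" if "poly_action p v = 0" for p
  proof -
    have "poly_action (p mod g) v = poly_action p v - poly_action (p div g * g) v"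
      by (metis poly_action_diff minus_div_mult_eq_mod)
    then have "poly_action (p mod g) v = 0"
      using that g by (simp add: poly_action_mult)
    then show ?thesis
      using least[of "p mod g"] degree_mod_less[OF g(1), of p] by (metis dvd_eq_mod_eq_0 not_le)
  qed
  with g show thesis
    by (intro that) (auto dest: poly_action_dvd)
qed

text \<open>
  Take \<open>v\<close> whose generator \<open>f\<close> of the annihilator has the largest degree. Suppose that \<open>f\<close> does not
  annihilate the whole space. Then there are an irreducible \<open>p\<close> and a vector \<open>x\<close> with
  \<open>f(T) x \<noteq> 0\<close> and \<open>(p f)(T) x = 0\<close>. Writing \<open>f = p\<^sup>a r\<close> with \<open>p\<close> not dividing \<open>r\<close>, the annihilators of
  \<open>p\<^sup>a(T) v\<close> and \<open>r(T) x\<close> are generated by the coprime polynomials \<open>r\<close> and \<open>p\<^sup>a\<^sup>+\<^sup>1\<close>, so that of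
  their sum is generated by \<open>p\<^sup>a\<^sup>+\<^sup>1 r = p f\<close>, which has larger degree than \<open>f\<close>.
\<close>

lemma vector_with_minimal_annihilator:
  obtains v where "v \<in> S" "\<And>p w. poly_action p v = 0 \<Longrightarrow> w \<in> S \<Longrightarrow> poly_action p w = 0"
proof -
  define gen where "gen v = (SOME g. g \<noteq> 0 \<and> (\<forall>p. poly_action p v = 0 \<longleftrightarrow> g dvd p))" for v
  have gen: "gen v \<noteq> 0 \<and> (\<forall>p. poly_action p v = 0 \<longleftrightarrow> gen v dvd p)" if "v \<in> S" for v
    unfolding gen_def by (rule someI_ex) (meson annihilator_generator[OF that])
  have "S \<noteq> {}"
    using subspace_0[OF subspace_S] by auto
  then obtain v where v: "v \<in> S" and max: "\<And>w. w \<in> S \<Longrightarrow> degree (gen w) \<le> degree (gen v)"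
    using finite_S Max_in[of "(\<lambda>v. degree (gen v)) ` S"] Max_ge[of "(\<lambda>v. degree (gen v)) ` S"]
    by (smt (verit, best) finite_imageI imageE image_eqI image_is_empty)
  define f where "f = gen v"
  have f: "f \<noteq> 0" "\<And>p. poly_action p v = 0 \<longleftrightarrow> f dvd p"
    using gen[OF v] by (auto simp: f_def)
  have "poly_action f w = 0" if "w \<in> S" for w
  proof (rule ccontr)
    assume "poly_action f w \<noteq> 0"
    define P where "P = (\<lambda>(c, w). c \<noteq> 0 \<and> w \<in> S \<and> poly_action f w \<noteq> 0 \<and> poly_action (c * f) w = 0)"
    have "P (gen w, w)"
      using gen[OF that] \<open>poly_action f w \<noteq> 0\<close> that by (auto simp: P_def)
    \<comment> \<open>Minimality of the degree, over all multipliers and all vectors at once, makes \<open>p\<close> irreducible: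
      a proper factor could be moved into the vector.\<close>
    then obtain p x where "P (p, x)" and least: "\<And>c y. P (c, y) \<Longrightarrow> degree p \<le> degree c"
      using ex_has_least_nat[of P _ "\<lambda>(c, w). degree c"] by fastforce
    then have p: "p \<noteq> 0" and x: "x \<in> S" "poly_action f x \<noteq> 0" "poly_action (p * f) x = 0"
      by (auto simp: P_def)
    have "irreducible p"
    proof (rule irreducibleI)
      show "\<not> p dvd 1"
        using x poly_action_dvd[of p 1 "poly_action f x"] by (auto simp only: poly_action_mult poly_action_1)
    next
      fix c d assume cd: "p = c * d"
      show "c dvd 1 \<or> d dvd 1"
      proof (cases "P (d, x)")
        case True
        then show ?thesis
          using least[OF True] cd p by (auto simp: degree_mult_eq is_unit_iff_degree)
      next
        case False
        have "poly_action f (poly_action d x) = poly_action (d * f) x"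
          by (simp add: poly_action_mult[symmetric] mult.commute)
        with False have "P (c, poly_action d x)"
          using x p cd by (auto simp: P_def poly_action_in_S poly_action_mult[symmetric] ac_simps)
        from least[OF this] show ?thesis
          using cd p by (auto simp: degree_mult_eq is_unit_iff_degree)
      qed
    qed (use p in auto)
    then have prime: "prime_elem p"
      by (rule field_poly_irreducible_imp_prime)
    have deg_p: "degree p > 0"
      using \<open>irreducible p\<close> p by (auto simp: irreducible_def is_unit_iff_degree)
    have "finite {n. p ^ n dvd f}"
    proof (rule finite_subset)
      show "{n. p ^ n dvd f} \<subseteq> {..degree f}"
      proof safe
        fix n assume "p ^ n dvd f"
        then have "degree (p ^ n) \<le> degree f"
          using f(1) by (rule dvd_imp_degree_le)
        moreover have "degree (p ^ n) = degree p * n"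
          by (rule degree_power_eq[OF p])
        moreover have "1 * n \<le> degree p * n"
          using deg_p by (intro mult_le_mono1) simp
        ultimately show "n \<le> degree f"
          by linarith
      qed
    qed auto
    moreover have "0 \<in> {n. p ^ n dvd f}"
      by simp
    then have "{n. p ^ n dvd f} \<noteq> {}"
      by blast
    ultimately obtain a where a: "p ^ a dvd f" "\<not> p ^ Suc a dvd f"
      by (metis (mono_tags) Max_ge Max_in Suc_n_not_le_n mem_Collect_eq)
    then obtain r where r: "f = p ^ a * r"
      unfolding dvd_def by blast
    have pr: "\<not> p dvd r"
      using a(2) r mult_dvd_mono[OF dvd_refl, of p r "p ^ a"] by (auto simp: mult.commute)
    have cancel: "p ^ n dvd c * y \<Longrightarrow> p dvd c \<or> p ^ n dvd y" for n c y
      using prime_elem_power_dvd_cases[of p n c y 1 n] prime by auto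
    define y where "y = poly_action r x"
    have y: "poly_action (p ^ Suc a) y = 0" "poly_action (p ^ a) y \<noteq> 0" "y \<in> S"
      using x r by (auto simp: y_def poly_action_mult[symmetric] poly_action_in_S ac_simps)
    have y_iff: "poly_action h y = 0 \<Longrightarrow> p ^ Suc a dvd h" for h
    proof -
      obtain k where k: "p ^ Suc a = gen y * k"
        using gen[OF y(3)] y(1) unfolding dvd_def by blast
      have "\<not> p dvd k"
      proof
        assume "p dvd k"
        then obtain k' where "k = p * k'" unfolding dvd_def by blast
        then have "p ^ a = gen y * k'" using k p by simp
        then show False using y gen by auto
      qed
      then have "p ^ Suc a dvd gen y"
        using cancel[of "Suc a" k "gen y"] k by (auto simp: mult.commute)
      moreover assume "poly_action h y = 0"
      ultimately show ?thesis using gen[OF y(3)] by (meson dvd_trans)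
    qed
    define z where "z = poly_action (p ^ a) v + y"
    have z: "z \<in> S"
      using y v subspace_S by (auto simp: z_def intro!: subspace_add poly_action_in_S)
    have z_iff: "p ^ Suc a * r dvd h" if "poly_action h z = 0" for h
    proof -
      have eq: "poly_action (c * h * p ^ a) v + poly_action (c * h) y = 0" for c
        using that by (simp add: z_def poly_action_mult poly_action.add[symmetric])
      have "poly_action (r * h * p ^ a) v = 0"
        using f(2)[of "r * h * p ^ a"] r by (simp add: ac_simps)
      then have "p ^ Suc a dvd r * h"
        using eq[of r] y_iff by simp
      then have ph: "p ^ Suc a dvd h"
        using cancel pr by blast
      have "poly_action (1 * h) y = 0"
        using poly_action_dvd[OF ph y(1)] by simp
      then have "f dvd h * p ^ a"
        using eq[of 1] f(2) by simp
      then have "r dvd h"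
        using r p by (simp add: mult.commute)
      then obtain k where k: "h = r * k" unfolding dvd_def by blast
      then have "p ^ Suc a dvd k" using ph cancel pr by blast
      then show ?thesis using k by (simp add: mult.commute mult_dvd_mono)
    qed
    have "p ^ Suc a * r dvd gen z"
      using gen[OF z] by (intro z_iff) auto
    then have "degree (p ^ Suc a * r) \<le> degree (gen z)"
      using gen[OF z] by (auto intro: dvd_imp_degree_le)
    moreover have "degree (p ^ Suc a * r) = degree p + degree f"
      using p f(1) r by (simp add: degree_mult_eq)
    ultimately show False
      using deg_p max[OF z] by (simp add: f_def)
  qed
  then show thesis
    using f that[OF v] by (meson poly_action_dvd)
qed

end

section \<open>Independent sets and linear maps on direct sums\<close>

context vector_space begin

lemma independent_family:
  fixes d :: nat
  assumes "\<And>k. k < d \<Longrightarrow> b k \<notin> span (b ` {..<k})"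
  shows "independent (b ` {..<d}) \<and> inj_on b {..<d}"
  using assms
proof (induction d)
  case (Suc d)
  then have "b d \<notin> span (b ` {..<d})" "independent (b ` {..<d})" "inj_on b {..<d}"
    by simp_all
  moreover from this have "b d \<notin> b ` {..<d}"
    by (auto intro: span_base)
  ultimately show ?case
    by (simp add: lessThan_Suc independent_insertI)
qed (simp add: independent_empty)

lemma independent_Un:
  assumes "independent B" "independent C" "span B \<inter> span C \<subseteq> {0}"
  shows "independent (B \<union> C)"
proof -
  have *: False if ind: "independent B" and inter: "span B \<inter> span C \<subseteq> {0}"
    and a: "a \<in> B" "a \<in> span (B \<union> C - {a})" for a B C
  proof -
    have "B \<union> C - {a} \<subseteq> (B - {a}) \<union> C" by auto
    then obtain x y where xy: "a = x + y" "x \<in> span (B - {a})" "y \<in> span C"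
      using a(2) span_mono[of "B \<union> C - {a}" "(B - {a}) \<union> C"] by (auto simp: span_Un)
    then have "y = a - x" by simp
    moreover have "a - x \<in> span B"
      using xy(2) a(1) span_mono[of "B - {a}" B] by (auto intro: span_diff span_base)
    ultimately have "y = 0" using inter xy by auto
    with xy ind a(1) show False by (auto simp: dependent_def)
  qed
  show ?thesis
    unfolding dependent_def using *[of B C] *[of C B] assms by (auto simp: Un_commute Int_commute)
qed

lemma linear_glue:
  assumes "subspace W" "subspace W'" "W \<inter> W' \<subseteq> {0}"
    and f: "Vector_Spaces.linear scale scale f" and g: "Vector_Spaces.linear scale scale g"
  obtains h where "Vector_Spaces.linear scale scale h"
    "\<And>x. x \<in> W \<Longrightarrow> h x = f x" "\<And>x. x \<in> W' \<Longrightarrow> h x = g x"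
proof -
  interpret vector_space_pair scale scale by unfold_locales
  obtain B where B: "B \<subseteq> W" "independent B" "W \<subseteq> span B" by (meson maximal_independent_subset)
  obtain C where C: "C \<subseteq> W'" "independent C" "W' \<subseteq> span C" by (meson maximal_independent_subset)
  have "span B = W" "span C = W'"
    using B C assms(1,2) span_minimal span_superset by blast+
  then have "independent (B \<union> C)"
    using B C assms(3) by (intro independent_Un) simp_all
  then obtain h where h: "Vector_Spaces.linear scale scale h" "\<forall>x\<in>B \<union> C. h x = (if x \<in> B then f x else g x)"
    using linear_independent_extend[of "B \<union> C" "\<lambda>x. if x \<in> B then f x else g x"] by blast
  have "x \<in> B \<Longrightarrow> x \<in> C \<Longrightarrow> f x = g x" for x
  proof -
    assume "x \<in> B" "x \<in> C"
    then have "x = 0" using B C assms(3) by auto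
    then show "f x = g x"
      using linear_0[OF f] linear_0[OF g] by simp
  qed
  then have "x \<in> C \<Longrightarrow> h x = g x" for x
    using h(2) by auto
  moreover have "x \<in> B \<Longrightarrow> h x = f x" for x
    using h(2) by auto
  ultimately show thesis
    using B(3) C(3) by (intro that[OF h(1)]) (meson linear_eq_on f g h(1) subsetD)+
qed

lemma linear_funpow:
  assumes "Vector_Spaces.linear scale scale f"
  shows "Vector_Spaces.linear scale scale (f ^^ i)"
proof (induction i)
  case (Suc i)
  then show ?case
    using Vector_Spaces.linear_compose[OF Suc assms] by (simp add: o_def)
qed (simp add: linear_id[unfolded id_def])

end

section \<open>Decompositions on invariant subspaces\<close>

context endomorphism begin

lemma linear_T_diff:
  "Vector_Spaces.linear scale scale e \<Longrightarrow> Vector_Spaces.linear scale scale (\<lambda>y. T y - e y)"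
proof -
  interpret vector_space_pair scale scale by unfold_locales
  show "Vector_Spaces.linear scale scale e \<Longrightarrow> Vector_Spaces.linear scale scale (\<lambda>y. T y - e y)"
    by (intro linear_compose_sub linear_T)
qed

text \<open>
  The summand \<open>e\<close> is linear on the whole space so that it can be treated as an ordinary linear map,
  although its properties are only required on \<open>S\<close>.
\<close>

definition clean_on :: "nat \<Rightarrow> 'v set \<Rightarrow> bool" where
  "clean_on m S \<longleftrightarrow> (\<exists>e. Vector_Spaces.linear scale scale e \<and>
     (\<forall>x\<in>S. e x \<in> S \<and> e (e x) = e x \<and> ((\<lambda>y. T y - e y) ^^ m) x = x))"

text \<open>
  On \<open>W \<oplus> W'\<close> the block diagonal sum of the two decompositions works.
\<close>

lemma clean_on_direct_sum:
  assumes W: "subspace W" "\<And>x. x \<in> W \<Longrightarrow> T x \<in> W" "clean_on m W"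
    and W': "subspace W'" "\<And>x. x \<in> W' \<Longrightarrow> T x \<in> W'" "clean_on m W'"
    and inter: "W \<inter> W' \<subseteq> {0}" and sum: "S = {x + y | x y. x \<in> W \<and> y \<in> W'}"
  shows "clean_on m S"
proof -
  obtain f where f: "Vector_Spaces.linear scale scale f"
    "\<And>x. x \<in> W \<Longrightarrow> f x \<in> W \<and> f (f x) = f x \<and> ((\<lambda>y. T y - f y) ^^ m) x = x"
    using W(3) by (auto simp: clean_on_def)
  obtain g where g: "Vector_Spaces.linear scale scale g"
    "\<And>x. x \<in> W' \<Longrightarrow> g x \<in> W' \<and> g (g x) = g x \<and> ((\<lambda>y. T y - g y) ^^ m) x = x"
    using W'(3) by (auto simp: clean_on_def)
  obtain h where h: "Vector_Spaces.linear scale scale h"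
    "\<And>x. x \<in> W \<Longrightarrow> h x = f x" "\<And>x. x \<in> W' \<Longrightarrow> h x = g x"
    using linear_glue[OF W(1) W'(1) inter f(1) g(1)] by blast
  have cong: "((\<lambda>y. T y - h y) ^^ i) x = ((\<lambda>y. T y - k y) ^^ i) x \<and> ((\<lambda>y. T y - k y) ^^ i) x \<in> V"
    if "subspace V" "\<And>x. x \<in> V \<Longrightarrow> T x \<in> V" "\<And>x. x \<in> V \<Longrightarrow> k x \<in> V" "\<And>x. x \<in> V \<Longrightarrow> h x = k x"
      "x \<in> V" for V k x i
    using that by (induction i) (auto intro: subspace_diff)
  interpret h: Vector_Spaces.linear scale scale h by fact
  interpret u: Vector_Spaces.linear scale scale "(\<lambda>y. T y - h y) ^^ i" for i
    by (intro linear_funpow linear_T_diff h(1))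
  show ?thesis
    unfolding clean_on_def
  proof (intro exI[of _ h] conjI ballI)
    fix z assume "z \<in> S"
    then obtain x y where z: "z = x + y" "x \<in> W" "y \<in> W'" using sum by auto
    show "h z \<in> S" using z f g h sum by (auto simp: h.add)
    show "h (h z) = h z" using z f g h by (simp add: h.add)
    show "((\<lambda>y. T y - h y) ^^ m) z = z"
      using z f(2) g(2) cong[of W f x m] cong[of W' g y m] W W' h by (simp add: u.add)
  qed (rule h)
qed

section \<open>Krylov subspaces\<close>

definition krylov :: "'v \<Rightarrow> nat \<Rightarrow> 'v set" where
  "krylov v k = span ((\<lambda>i. (T ^^ i) v) ` {..<k})"

lemma subspace_krylov: "subspace (krylov v k)"
  by (simp add: krylov_def)

lemma krylov_0 [simp]: "krylov v 0 = {0}"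
  by (simp add: krylov_def)

lemma krylov_base: "i < k \<Longrightarrow> (T ^^ i) v \<in> krylov v k"
  by (auto simp: krylov_def intro: span_base)

lemma krylov_mono: "k \<le> l \<Longrightarrow> krylov v k \<subseteq> krylov v l"
  unfolding krylov_def by (intro span_mono) auto

lemma krylov_Suc: "x \<in> krylov v (Suc k) \<longleftrightarrow> (\<exists>c. x - c *s (T ^^ k) v \<in> krylov v k)"
  by (simp add: krylov_def lessThan_Suc span_breakdown_eq)

lemma T_krylov: "x \<in> krylov v k \<Longrightarrow> T x \<in> krylov v (Suc k)"
proof -
  have "span ((\<lambda>i. (T ^^ i) v) ` {..<k}) \<subseteq> {x. T x \<in> krylov v (Suc k)}"
    using krylov_base[of "Suc _" "Suc k" v]
    by (intro span_minimal T.subspace_linear_preimage) (auto simp: krylov_def)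
  then show "x \<in> krylov v k \<Longrightarrow> T x \<in> krylov v (Suc k)"
    unfolding krylov_def by auto
qed

lemma funpow_krylov: "x \<in> krylov v k \<Longrightarrow> (T ^^ i) x \<in> krylov v (i + k)"
  by (induction i) (auto dest: T_krylov)

lemma T_krylov_invariant:
  assumes "(T ^^ d) v \<in> krylov v d" "x \<in> krylov v d"
  shows "T x \<in> krylov v d"
proof -
  have "insert ((T ^^ d) v) (krylov v d) = krylov v d"
    using assms by auto
  then have "krylov v (Suc d) = krylov v d"
    using span_redundant[of "(T ^^ d) v" "(\<lambda>i. (T ^^ i) v) ` {..<d}"] assms(1)
    by (simp add: krylov_def lessThan_Suc)
  then show ?thesis using T_krylov[OF assms(2)] by simp
qed

text \<open>
  The basis in which the diagonal of \<open>T\<close> is prescribed: \<open>(T - \<delta>\<^sub>k\<^sub>-\<^sub>1) \<dots> (T - \<delta>\<^sub>0) v\<close>.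
\<close>

primrec shifted :: "(nat \<Rightarrow> 'a) \<Rightarrow> 'v \<Rightarrow> nat \<Rightarrow> 'v" where
  "shifted \<delta> v 0 = v"
| "shifted \<delta> v (Suc k) = T (shifted \<delta> v k) - \<delta> k *s shifted \<delta> v k"

text \<open>
  The coefficient of \<open>X\<^sup>k\<close> in \<open>(X - \<delta>\<^sub>k) \<dots> (X - \<delta>\<^sub>0)\<close> is minus the sum of the \<open>\<delta>\<^sub>i\<close>. On a cyclic
  space of dimension \<open>k + 1\<close> this makes \<open>\<delta>\<^sub>k\<close> the last diagonal entry of \<open>T\<close> when the \<open>\<delta>\<^sub>i\<close> sum to the
  trace.
\<close>

lemma shifted_second_coeff:
  "shifted \<delta> v (Suc k) - (T ^^ Suc k) v + (\<Sum>i\<le>k. \<delta> i) *s (T ^^ k) v \<in> krylov v k"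
proof (induction k)
  case (Suc k)
  let ?s = "\<Sum>i\<le>k. \<delta> i" and ?r = "shifted \<delta> v (Suc k) - (T ^^ Suc k) v"
  have "?r + ?s *s (T ^^ k) v \<in> krylov v (Suc k)"
    using Suc krylov_mono[of k "Suc k" v] by auto
  then have "?r \<in> krylov v (Suc k)"
    using subspace_krylov krylov_base[of k "Suc k" v]
    by (metis add_diff_cancel_right' lessI subspace_diff subspace_scale)
  then have "\<delta> (Suc k) *s ?r \<in> krylov v (Suc k)"
    by (intro subspace_scale subspace_krylov)
  moreover have "T (?r + ?s *s (T ^^ k) v) \<in> krylov v (Suc k)"
    by (rule T_krylov[OF Suc])
  ultimately have "T (?r + ?s *s (T ^^ k) v) - \<delta> (Suc k) *s ?r \<in> krylov v (Suc k)"
    by (intro subspace_diff subspace_krylov)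
  then show ?case
    by (simp add: T.add T.diff T.scale algebra_simps scale_right_diff_distrib)
qed simp

lemma shifted_diff_krylov: "shifted \<delta> v k - (T ^^ k) v \<in> krylov v k"
proof (cases k)
  case (Suc j)
  have "shifted \<delta> v (Suc j) - (T ^^ Suc j) v + (\<Sum>i\<le>j. \<delta> i) *s (T ^^ j) v \<in> krylov v (Suc j)"
    using shifted_second_coeff[of \<delta> v j] krylov_mono[of j "Suc j" v] by auto
  then show ?thesis
    using Suc subspace_krylov krylov_base[of j "Suc j" v]
    by (metis add_diff_cancel_right' lessI subspace_diff subspace_scale)
qed simp

lemma span_shifted: "span (shifted \<delta> v ` {..<k}) = krylov v k"
proof (induction k)
  case (Suc k)
  have "span (insert (shifted \<delta> v k) (krylov v k)) = span (insert ((T ^^ k) v) (krylov v k))"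
    using shifted_diff_krylov[of \<delta> v k] by (intro eq_span_insert_eq) (rule span_base)
  moreover have "span (insert y (span A)) = span (insert y A)" for y A
    by (auto simp: span_insert span_span)
  ultimately show ?case
    using Suc by (simp add: krylov_def lessThan_Suc) metis
qed simp

section \<open>Cyclic subspaces\<close>

lemma funpow_eigenvector:
  assumes "Vector_Spaces.linear scale scale u" "u x = c *s x"
  shows "(u ^^ m) x = c ^ m *s x"
proof -
  interpret u: Vector_Spaces.linear scale scale u by fact
  show ?thesis
    by (induction m) (simp_all add: u.scale assms(2) mult.commute)
qed

text \<open>
  The scalar \<open>\<tau>\<close> is the trace of \<open>T\<close> on the cyclic space spanned by \<open>v, T v, \<dots>, T\<^sup>n v\<close>.
\<close>

lemma clean_on_cyclic:
  fixes \<epsilon> \<mu> :: "nat \<Rightarrow> 'a"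
  assumes power: "\<And>c :: 'a. c \<noteq> 0 \<Longrightarrow> c ^ m = 1"
    and ind: "\<And>k. k \<le> n \<Longrightarrow> (T ^^ k) v \<notin> krylov v k"
    and dep: "(T ^^ Suc n) v - \<tau> *s (T ^^ n) v \<in> krylov v n"
    and trace: "(\<Sum>i\<le>n. \<epsilon> i + \<mu> i) = \<tau>"
    and eps: "\<And>i. i \<le> n \<Longrightarrow> \<epsilon> i = 0 \<or> \<epsilon> i = 1" "\<And>i. i < n \<Longrightarrow> \<epsilon> i + \<epsilon> (Suc i) = 1"
    and mu: "\<And>i. i \<le> n \<Longrightarrow> \<mu> i \<noteq> 0" "\<And>i. i < n \<Longrightarrow> \<mu> i \<noteq> \<mu> (Suc i)" "\<And>i. i < n \<Longrightarrow> \<mu> i \<noteq> \<mu> n"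
  shows "clean_on m (krylov v (Suc n))"
proof -
  define \<delta> where "\<delta> i = \<epsilon> i + \<mu> i" for i
  define b where "b = shifted \<delta> v"
  define y where "y = b (Suc n)"
  have span_b: "span (b ` {..<k}) = krylov v k" for k
    by (simp add: b_def span_shifted)
  have b_notin: "b k \<notin> span (b ` {..<k})" if "k < Suc n" for k
  proof
    assume "b k \<in> span (b ` {..<k})"
    from subspace_diff[OF subspace_krylov this[unfolded span_b] shifted_diff_krylov[of \<delta> v k, folded b_def]]
    have "(T ^^ k) v \<in> krylov v k" by simp
    then show False using ind[of k] that by simp
  qed
  have indep: "independent (b ` {..<Suc n})" and inj: "inj_on b {..<Suc n}"
    using independent_family[of "Suc n" b] b_notin by auto
  have T_b: "T (b i) = \<delta> i *s b i + b (Suc i)" for i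
    by (simp add: b_def)
  \<comment> \<open>The last column: the trace condition removes its diagonal entry.\<close>
  have y: "y \<in> span (b ` {..<n})"
  proof -
    have "y - (T ^^ Suc n) v + \<tau> *s (T ^^ n) v \<in> krylov v n"
      using shifted_second_coeff[of \<delta> v n] trace by (simp add: y_def b_def \<delta>_def)
    from subspace_add[OF subspace_krylov this dep] show ?thesis
      by (simp add: span_b)
  qed
  \<comment> \<open>\<open>lnk i\<close>: the entry that maps \<open>b i\<close> to \<open>b (Suc i)\<close> belongs to \<open>e\<close>, otherwise to \<open>u\<close>. Alternation
    keeps the blocks at size two; counting from the end gives the entry that leads to \<open>b n\<close> to \<open>e\<close>, so that
    \<open>u\<close> preserves the span of the earlier vectors.\<close>
  define lnk where "lnk i \<longleftrightarrow> i < n \<and> odd (n - i)" for i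
  have lnk: "lnk i \<Longrightarrow> \<not> lnk (Suc i)" "i < n \<Longrightarrow> \<not> lnk i \<Longrightarrow> lnk (Suc i)" for i
    unfolding lnk_def by presburger+
  interpret vector_space_pair scale scale by unfold_locales
  define E where "E i = \<epsilon> i *s b i + (if lnk i then b (Suc i) else 0)" for i
  obtain e where lin_e: "Vector_Spaces.linear scale scale e"
    and "\<forall>x\<in>b ` {..<Suc n}. e x = E (the_inv_into {..<Suc n} b x)"
    using linear_independent_extend[OF indep, of "\<lambda>x. E (the_inv_into {..<Suc n} b x)"] by blast
  then have e_b: "e (b i) = \<epsilon> i *s b i + (if lnk i then b (Suc i) else 0)" if "i \<le> n" for i
    using that by (simp add: the_inv_into_f_f[OF inj] E_def)
  interpret e: Vector_Spaces.linear scale scale e by fact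
  define u where "u x = T x - e x" for x
  have lin_u: "Vector_Spaces.linear scale scale u"
    unfolding u_def by (rule linear_T_diff[OF lin_e])
  interpret u: Vector_Spaces.linear scale scale u by fact
  have u_b: "u (b i) = \<mu> i *s b i + (if lnk i then 0 else b (Suc i))" if "i \<le> n" for i
    using that by (simp add: u_def T_b e_b \<delta>_def scale_left_distrib)
  \<comment> \<open>Eigenvectors whose eigenvalue is not the last one; on their span, \<open>\<mu> n - u\<close> is onto.\<close>
  define X where "X = {x. \<exists>c. c \<noteq> 0 \<and> c \<noteq> \<mu> n \<and> u x = c *s x}"
  have link: "b i \<in> X" if "lnk i" for i
  proof -
    have "i < n" using that by (simp add: lnk_def)
    then show ?thesis
      using that mu(1,3) u_b[of i] by (auto simp: X_def intro!: exI[of _ "\<mu> i"])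
  qed
  have b_X: "b i \<in> span X" if "i < n" for i
  proof (cases "lnk i")
    case True
    then show ?thesis by (intro span_base link)
  next
    case False
    then have Suc: "lnk (Suc i)" using lnk that by blast
    \<comment> \<open>\<open>b i + c b (Suc i)\<close> is the second eigenvector of the block on \<open>b i\<close> and \<open>b (Suc i)\<close>.\<close>
    define c where "c = 1 / (\<mu> i - \<mu> (Suc i))"
    have "1 + c * \<mu> (Suc i) = \<mu> i * c"
      using mu(2)[OF that] by (simp add: c_def field_simps)
    then have "u (b i + c *s b (Suc i)) = \<mu> i *s (b i + c *s b (Suc i))"
      using False Suc that by (simp add: u.add u.scale u_b scale_right_distrib)
        (metis scale_left_distrib scale_one)
    then have "b i + c *s b (Suc i) \<in> X"
      using mu(1,3) that by (auto simp: X_def intro!: exI[of _ "\<mu> i"])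
    then have "(b i + c *s b (Suc i)) - c *s b (Suc i) \<in> span X"
      using link[OF Suc] by (intro span_diff span_scale span_base)
    then show ?thesis by simp
  qed
  have "y \<in> span X"
    using y b_X span_minimal[OF _ subspace_span, of "b ` {..<n}" X] by auto
  moreover have "span X \<subseteq> (\<lambda>z. \<mu> n *s z - u z) ` span X"
  proof (rule span_minimal)
    show "X \<subseteq> (\<lambda>z. \<mu> n *s z - u z) ` span X"
    proof
      fix x assume "x \<in> X"
      then obtain c where c: "c \<noteq> \<mu> n" "u x = c *s x" by (auto simp: X_def)
      define z where "z = (1 / (\<mu> n - c)) *s x"
      have "\<mu> n *s z - u z = ((\<mu> n - c) * (1 / (\<mu> n - c))) *s x"
        by (simp only: z_def u.scale c(2) scale_scale left_diff_distrib scale_left_diff_distrib mult.commute)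
      also have "\<dots> = x" using c(1) by simp
      finally show "x \<in> (\<lambda>z. \<mu> n *s z - u z) ` span X"
        using \<open>x \<in> X\<close> by (intro image_eqI[of _ _ z]) (auto simp: z_def intro: span_scale span_base)
    qed
    interpret g: Vector_Spaces.linear scale scale "\<lambda>z. \<mu> n *s z - u z"
      by (intro linear_compose_sub linear_scale_self lin_u)
    show "subspace ((\<lambda>z. \<mu> n *s z - u z) ` span X)"
      by (intro g.subspace_image subspace_span)
  qed
  ultimately obtain z where z: "z \<in> span X" "\<mu> n *s z - u z = y"
    by blast
  \<comment> \<open>Adding \<open>z\<close> turns \<open>b n\<close> into an eigenvector for \<open>\<mu> n\<close>.\<close>
  define F where "F = {x. (u ^^ m) x = x}"
  have F: "subspace F"
  proof -
    interpret um: Vector_Spaces.linear scale scale "\<lambda>x. (u ^^ m) x - x"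
      by (intro linear_compose_sub linear_funpow lin_u linear_ident)
    show ?thesis
      using um.subspace_kernel by (simp add: F_def)
  qed
  have eig_F: "x \<in> F" if "u x = c *s x" "c \<noteq> 0" for x c
    using funpow_eigenvector[OF lin_u that(1), of m] power[OF that(2)] by (simp add: F_def)
  have span_X: "span X \<subseteq> F"
    using F by (intro span_minimal) (auto simp: X_def intro: eig_F)
  have "b i \<in> F" if "i \<le> n" for i
  proof (cases "i = n")
    case True
    have "u (b n + z) = \<mu> n *s (b n + z)"
      using z u_b[of n] by (simp add: u.add lnk_def y_def scale_right_distrib algebra_simps)
    then have "b n + z \<in> F" using mu by (auto intro: eig_F)
    then have "(b n + z) - z \<in> F"
      using z span_X by (intro subspace_diff F) auto
    then show ?thesis using True by simp
  qed (use that b_X span_X in auto)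
  then have u_id: "krylov v (Suc n) \<subseteq> F"
    unfolding span_b[symmetric] using F by (intro span_minimal) auto
  have e_in: "krylov v (Suc n) \<subseteq> {x. e x \<in> krylov v (Suc n)}"
  proof -
    have "e (b i) \<in> span (b ` {..<Suc n})" if "i < Suc n" for i
      using that by (auto simp: e_b lnk_def intro!: span_add span_scale[OF span_base] span_base[of "b (Suc _)"])
    then show ?thesis
      unfolding span_b[symmetric] by (intro span_minimal e.subspace_linear_preimage) auto
  qed
  have e_idem: "krylov v (Suc n) \<subseteq> {x. e (e x) = e x}"
  proof -
    have "e (e (b i)) = e (b i)" if "i < Suc n" for i
    proof (cases "lnk i")
      case True
      then have i: "i < n" "\<not> lnk (Suc i)" using lnk by (auto simp: lnk_def)
      have "e (e (b i)) = (\<epsilon> i * \<epsilon> i) *s b i + (\<epsilon> i + \<epsilon> (Suc i)) *s b (Suc i)"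
        using i True by (simp add: e_b e.add e.scale scale_right_distrib scale_left_distrib)
      then show ?thesis
        using i True eps(1)[of i] eps(2)[of i] by (auto simp: e_b)
    next
      case False
      then show ?thesis using that eps(1)[of i] by (auto simp: e_b e.scale)
    qed
    moreover have "subspace {x. e (e x) = e x}"
      by (rule subspaceI) (auto simp: e.add e.scale)
    ultimately show ?thesis
      unfolding span_b[symmetric] by (intro span_minimal) auto
  qed
  show ?thesis
    unfolding clean_on_def u_def[symmetric] using lin_e u_id e_in e_idem
    by (intro exI[of _ e]) (auto simp: F_def u_def[abs_def])
qed

end

section \<open>Prescribing the diagonals of the two summands\<close>

lemma exists_avoiding:
  fixes A :: "'a set"
  assumes "finite A" "card A < CARD('a)"
  shows "\<exists>x. x \<notin> A"
  using assms by (metis UNIV_eq_I less_irrefl)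

lemma card_insert_le_3: "card {a, b, c} \<le> 3"
  using card_length[of "[a, b, c]"] by simp

text \<open>
  The indices run backwards compared to \<open>clean_on_cyclic\<close>, so that \<open>\<mu> 0\<close> is the eigenvalue that must not
  recur and the sequences can be lengthened at their ends. Lengthening by two adds a pair
  \<open>(0, 1)\<close> or \<open>(1, 0)\<close> to \<open>\<epsilon>\<close> and a pair \<open>(c, -c)\<close> to \<open>\<mu>\<close>, hence changes the sum by \<open>1\<close> whatever
  \<open>c\<close> is; the sign of \<open>c\<close> is free to avoid the preceding entry.
\<close>

lemma diagonal_choice:
  fixes \<tau> :: "'a::field"
  assumes card: "CARD('a) \<ge> 4" and two: "(2::'a) \<noteq> 0"
  shows "\<exists>\<epsilon> \<mu>. (\<forall>j\<le>n. \<epsilon> j = 0 \<or> \<epsilon> j = 1) \<and> (\<forall>j<n. \<epsilon> j + \<epsilon> (Suc j) = 1)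
    \<and> (\<forall>j\<le>n. \<mu> j \<noteq> 0) \<and> (\<forall>j<n. \<mu> j \<noteq> \<mu> (Suc j)) \<and> (\<forall>j<n. \<mu> (Suc j) \<noteq> \<mu> 0)
    \<and> (\<Sum>j\<le>n. \<epsilon> j + \<mu> j) = \<tau>"
proof (induction n arbitrary: \<tau> rule: induct_nat_012)
  case 0
  show ?case
  proof (cases "\<tau> = 0")
    case True
    then show ?thesis by (intro exI[of _ "\<lambda>_. 1"] exI[of _ "\<lambda>_. -1"]) auto
  next
    case False
    then show ?thesis by (intro exI[of _ "\<lambda>_. 0"] exI[of _ "\<lambda>_. \<tau>"]) auto
  qed
next
  case 1
  have "card {0, \<tau> - 1, (\<tau> - 1) / 2} \<le> 3"
    by (rule card_insert_le_3)
  \<comment> \<open>With \<open>\<epsilon> = (0, 1)\<close> the two eigenvalues are \<open>c\<close> and \<open>\<tau> - 1 - c\<close>; the three excluded values make one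
    of them zero or both equal.\<close>
  then obtain c where c: "c \<notin> {0, \<tau> - 1, (\<tau> - 1) / 2}"
    using exists_avoiding[of "{0, \<tau> - 1, (\<tau> - 1) / 2}"] card by auto
  have "c \<noteq> \<tau> - 1 - c"
  proof
    assume "c = \<tau> - 1 - c"
    then have "c = (\<tau> - 1) / 2" using two by (simp add: field_simps)
    with c show False by simp
  qed
  then show ?case
    using c by (intro exI[of _ "\<lambda>j. if j = 0 then 0 else 1"] exI[of _ "\<lambda>j. if j = 0 then c else \<tau> - 1 - c"]) auto
next
  case (ge2 n)
  then obtain \<epsilon> \<mu> where IH: "\<forall>j\<le>n. \<epsilon> j = 0 \<or> \<epsilon> j = 1" "\<forall>j<n. \<epsilon> j + \<epsilon> (Suc j) = 1"
    "\<forall>j\<le>n. \<mu> j \<noteq> 0" "\<forall>j<n. \<mu> j \<noteq> \<mu> (Suc j)" "\<forall>j<n. \<mu> (Suc j) \<noteq> \<mu> 0"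
    "(\<Sum>j\<le>n. \<epsilon> j + \<mu> j) = \<tau> - 1"
    using ge2(1)[of "\<tau> - 1"] by blast
  have "card {0, \<mu> 0, - \<mu> 0} \<le> 3"
    by (rule card_insert_le_3)
  then obtain a where a: "a \<notin> {0, \<mu> 0, - \<mu> 0}"
    using exists_avoiding[of "{0, \<mu> 0, - \<mu> 0}"] card by auto
  have not_neg: "x \<noteq> - x" if "x \<noteq> 0" for x :: 'a
    using two that by (metis add_eq_0_iff mult_2 mult_eq_0_iff)
  define c where "c = (if \<mu> n = a then - a else a)"
  have c: "c \<noteq> 0" "c \<noteq> \<mu> 0" "- c \<noteq> \<mu> 0" "\<mu> n \<noteq> c" "c \<noteq> - c"
    using a not_neg[of a] by (auto simp: c_def eq_neg_iff_add_eq_0 neg_eq_iff_add_eq_0 add.commute)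
  define \<epsilon>' where "\<epsilon>' j = (if j \<le> n then \<epsilon> j else if j = Suc n then 1 - \<epsilon> n else \<epsilon> n)" for j
  define \<mu>' where "\<mu>' j = (if j \<le> n then \<mu> j else if j = Suc n then c else - c)" for j
  have "(\<Sum>j\<le>n. \<epsilon>' j + \<mu>' j) = (\<Sum>j\<le>n. \<epsilon> j + \<mu> j)"
    by (rule sum.cong) (auto simp: \<epsilon>'_def \<mu>'_def)
  then have "(\<Sum>j\<le>Suc (Suc n). \<epsilon>' j + \<mu>' j) = \<tau>"
    using IH(6) by (simp add: \<epsilon>'_def \<mu>'_def)
  then show ?case
    using IH c by (intro exI[of _ \<epsilon>'] exI[of _ \<mu>'])
      (auto simp: \<epsilon>'_def \<mu>'_def less_Suc_eq le_Suc_eq)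
qed

section \<open>Splitting off a cyclic summand\<close>

lemma (in endomorphism) krylov_coefficients:
  "x \<in> krylov v k \<Longrightarrow> \<exists>c. x = (\<Sum>i<k. c i *s (T ^^ i) v)"
proof (induction k arbitrary: x)
  case (Suc k)
  then obtain a c where "x - a *s (T ^^ k) v = (\<Sum>i<k. c i *s (T ^^ i) v)"
    by (meson krylov_Suc)
  then have "x = (\<Sum>i<Suc k. (c(k := a)) i *s (T ^^ i) v)"
    by (simp add: algebra_simps)
  then show ?case by blast
qed simp

context finite_invariant_subspace begin

lemma krylov_in_S: "v \<in> S \<Longrightarrow> krylov v k \<subseteq> S"
  unfolding krylov_def by (intro span_minimal subspace_S) (auto intro: funpow_in_S)

lemma krylov_stabilises:
  assumes "v \<in> S" "v \<noteq> 0"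
  obtains n where "\<And>k. k \<le> n \<Longrightarrow> (T ^^ k) v \<notin> krylov v k" "(T ^^ Suc n) v \<in> krylov v (Suc n)"
proof -
  have "\<exists>d. (T ^^ d) v \<in> krylov v d"
  proof (rule ccontr)
    assume *: "\<nexists>d. (T ^^ d) v \<in> krylov v d"
    have "(T ^^ i) v \<noteq> (T ^^ j) v" if "i < j" for i j
      using * krylov_base[OF that] by metis
    then have "inj (\<lambda>i. (T ^^ i) v)"
      by (rule linorder_injI)
    moreover have "range (\<lambda>i. (T ^^ i) v) \<subseteq> S"
      using funpow_in_S assms by auto
    ultimately show False
      using finite_S by (meson finite_imageD finite_subset infinite_UNIV_nat)
  qed
  then obtain d where d: "(T ^^ d) v \<in> krylov v d" "\<And>k. k < d \<Longrightarrow> (T ^^ k) v \<notin> krylov v k"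
    using exists_least_iff[of "\<lambda>d. (T ^^ d) v \<in> krylov v d"] by blast
  moreover have "d \<noteq> 0"
    using d(1) assms(2) by (cases d) auto
  ultimately show thesis
    by (intro that[of "d - 1"]) (auto simp del: funpow.simps)
qed

text \<open>
  Let \<open>\<phi>\<close> be a linear form with \<open>\<phi>(T\<^sup>n v) = 1\<close> and \<open>\<phi>(T\<^sup>i v) = 0\<close> for \<open>i < n\<close>. The vectors \<open>w\<close> with
  \<open>\<phi>(T\<^sup>i w) = 0\<close> for all \<open>i\<close> form an invariant subspace. The matrix \<open>\<phi>(T\<^sup>i\<^sup>+\<^sup>j v)\<close>, for \<open>i, j \<le> n\<close>, is
  triangular with ones on the antidiagonal, hence the conditions for \<open>i \<le> n\<close> cut out a complement of
  the cyclic subspace. The conditions for larger \<open>i\<close> follow from these, because the relation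
  that expresses \<open>T\<^sup>n\<^sup>+\<^sup>1 v\<close> by lower powers holds for every vector of \<open>S\<close>, like every polynomial
  relation satisfied by \<open>v\<close>.
\<close>

lemma krylov_complement:
  assumes v: "v \<in> S" and max: "\<And>p w. poly_action p v = 0 \<Longrightarrow> w \<in> S \<Longrightarrow> poly_action p w = 0"
    and ind: "\<And>k. k \<le> n \<Longrightarrow> (T ^^ k) v \<notin> krylov v k"
    and dep: "(T ^^ Suc n) v \<in> krylov v (Suc n)"
  obtains W' where "subspace W'" "W' \<subseteq> S" "\<And>x. x \<in> W' \<Longrightarrow> T x \<in> W'"
    "krylov v (Suc n) \<inter> W' \<subseteq> {0}" "S = {x + y | x y. x \<in> krylov v (Suc n) \<and> y \<in> W'}"
proof -
  let ?W = "krylov v (Suc n)"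
  interpret F: vector_space "(*) :: 'a \<Rightarrow> 'a \<Rightarrow> 'a"
    by unfold_locales (simp_all add: algebra_simps)
  interpret vector_space_pair scale "(*) :: 'a \<Rightarrow> 'a \<Rightarrow> 'a"
    by unfold_locales
  have "independent ((\<lambda>i. (T ^^ i) v) ` {..<Suc n})" and inj: "inj_on (\<lambda>i. (T ^^ i) v) {..<Suc n}"
    using independent_family[of "Suc n" "\<lambda>i. (T ^^ i) v"] ind by (auto simp: krylov_def)
  then obtain \<phi> where lin: "Vector_Spaces.linear scale (*) \<phi>"
    and "\<forall>x\<in>(\<lambda>i. (T ^^ i) v) ` {..<Suc n}. \<phi> x = (if x = (T ^^ n) v then 1 else 0)"
    using linear_independent_extend[of _ "\<lambda>x. if x = (T ^^ n) v then 1 else 0"] by blast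
  then have \<phi>: "\<phi> ((T ^^ i) v) = (if i = n then 1 else 0)" if "i \<le> n" for i
    using inj that by (auto simp: inj_on_def)
  interpret \<phi>: Vector_Spaces.linear scale "(*)" \<phi> by fact
  interpret Ti: Vector_Spaces.linear scale scale "T ^^ i" for i
    by (intro linear_funpow linear_T)
  have \<phi>_krylov: "\<phi> x = 0" if "x \<in> krylov v n" for x
    by (rule \<phi>.eq_0_on_span[OF _ that[unfolded krylov_def]]) (auto simp: \<phi>)
  define W' where "W' = {w \<in> S. \<forall>i. \<phi> ((T ^^ i) w) = 0}"
  have sub: "subspace W'"
    using subspace_S by (auto simp: W'_def subspace_def \<phi>.add \<phi>.scale Ti.add Ti.scale)
  have inv: "T x \<in> W'" if "x \<in> W'" for x
  proof -
    have "(T ^^ i) (T x) = (T ^^ Suc i) x" for i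
      by (simp add: funpow_swap1)
    then show ?thesis
      using that by (auto simp: W'_def T_in_S simp del: funpow.simps)
  qed
  have inter: "x = 0" if "x \<in> krylov v k" "k \<le> Suc n" "x \<in> W'" for x k
    using that
  proof (induction k arbitrary: x)
    case (Suc k)
    obtain c where c: "x - c *s (T ^^ k) v \<in> krylov v k"
      using Suc.prems(1) krylov_Suc by blast
    define l where "l = x - c *s (T ^^ k) v"
    have "(T ^^ (n - k)) l \<in> krylov v n"
      using funpow_krylov[of l v k "n - k"] c Suc.prems by (simp add: l_def)
    then have "\<phi> ((T ^^ (n - k)) l) = 0" by (rule \<phi>_krylov)
    moreover have "(T ^^ (n - k)) ((T ^^ k) v) = (T ^^ n) v"
      using Suc.prems by (simp add: funpow_add[symmetric, THEN fun_cong, unfolded o_apply])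
    ultimately have "c = 0"
      using Suc.prems \<phi>[of n] by (simp add: l_def W'_def Ti.diff Ti.scale \<phi>.diff \<phi>.scale)
    then show ?case using Suc c by simp
  qed simp
  have match: "\<exists>x\<in>?W. \<forall>i<k. \<phi> ((T ^^ i) x) = \<phi> ((T ^^ i) w)" if "k \<le> Suc n" for k w
    using that
  proof (induction k)
    case 0
    then show ?case by (auto simp: krylov_def intro: span_zero)
  next
    case (Suc k)
    then obtain x where x: "x \<in> ?W" "\<forall>i<k. \<phi> ((T ^^ i) x) = \<phi> ((T ^^ i) w)" by auto
    define c where "c = \<phi> ((T ^^ k) w) - \<phi> ((T ^^ k) x)"
    have "\<phi> ((T ^^ i) ((T ^^ (n - k)) v)) = (if i = k then 1 else 0)" if "i \<le> k" for i
    proof -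
      have "(T ^^ i) ((T ^^ (n - k)) v) = (T ^^ (i + (n - k))) v"
        by (simp only: funpow_add o_apply)
      moreover have "i + (n - k) \<le> n" "i + (n - k) = n \<longleftrightarrow> i = k"
        using that Suc.prems by auto
      ultimately show ?thesis using \<phi>[of "i + (n - k)"] by simp
    qed
    then have "\<forall>i<Suc k. \<phi> ((T ^^ i) (x + c *s (T ^^ (n - k)) v)) = \<phi> ((T ^^ i) w)"
      using x by (auto simp: Ti.add Ti.scale \<phi>.add \<phi>.scale c_def less_Suc_eq)
    moreover have "x + c *s (T ^^ (n - k)) v \<in> ?W"
      using x by (intro subspace_add subspace_scale subspace_krylov krylov_base) auto
    ultimately show ?case by blast
  qed
  obtain c where c: "(T ^^ Suc n) v = (\<Sum>i<Suc n. c i *s (T ^^ i) v)"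
    using krylov_coefficients[OF dep] by blast
  have recurrence: "(T ^^ Suc n) w = (\<Sum>i<Suc n. c i *s (T ^^ i) w)" if "w \<in> S" for w
  proof -
    have poly_action_sum: "poly_action (sum f A) x = (\<Sum>i\<in>A. poly_action (f i) x)" for f :: "nat \<Rightarrow> 'a poly" and A x
      by (induction A rule: infinite_finite_induct) (simp_all add: poly_action_add)
    let ?p = "Polynomial.monom 1 (Suc n) - (\<Sum>i<Suc n. Polynomial.monom (c i) i)"
    have p: "poly_action ?p x = (T ^^ Suc n) x - (\<Sum>i<Suc n. c i *s (T ^^ i) x)" for x
      by (simp only: poly_action_diff poly_action_sum poly_action_monom scale_one)
    have "poly_action ?p v = 0" unfolding p using c by simp
    then have "poly_action ?p w = 0" using that by (rule max)
    then show ?thesis unfolding p by simp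
  qed
  have vanish: "\<phi> ((T ^^ i) y) = 0" if y: "y \<in> S" "\<forall>i<Suc n. \<phi> ((T ^^ i) y) = 0" for y i
  proof (induction i rule: less_induct)
    case (less i)
    show ?case
    proof (cases "i < Suc n")
      case False
      define k where "k = i - Suc n"
      have i: "i = Suc n + k" using False by (simp add: k_def)
      have "(T ^^ i) y = (\<Sum>j<Suc n. c j *s (T ^^ (j + k)) y)"
        using recurrence[OF funpow_in_S[OF y(1), of k]]
        unfolding i by (simp only: funpow_add o_apply)
      then show ?thesis
        using less i by (auto simp only: \<phi>.sum \<phi>.scale intro!: sum.neutral) simp
    qed (use y in auto)
  qed
  have sum: "S = {x + y | x y. x \<in> ?W \<and> y \<in> W'}"
  proof safe
    fix w assume "w \<in> S"
    obtain x where x: "x \<in> ?W" "\<forall>i<Suc n. \<phi> ((T ^^ i) x) = \<phi> ((T ^^ i) w)"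
      using match[of "Suc n" w] by auto
    have "w - x \<in> S"
      using krylov_in_S[OF v, of "Suc n"] x \<open>w \<in> S\<close> subspace_S by (auto intro: subspace_diff)
    then have "w - x \<in> W'"
      using x vanish[of "w - x"] by (auto simp: W'_def Ti.diff \<phi>.diff)
    then show "\<exists>x y. w = x + y \<and> x \<in> ?W \<and> y \<in> W'"
      using x by (intro exI[of _ x] exI[of _ "w - x"]) auto
  next
    fix x y assume "x \<in> ?W" "y \<in> W'"
    then show "x + y \<in> S"
      using krylov_in_S[OF v, of "Suc n"] subspace_S by (auto simp: W'_def intro: subspace_add)
  qed
  have W'_S: "W' \<subseteq> S"
    by (auto simp: W'_def)
  have W_W': "?W \<inter> W' \<subseteq> {0}"
    using inter[of _ "Suc n"] by blast
  show thesis
    by (rule that[OF sub W'_S inv W_W' sum])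
qed

end

text \<open>
  Induction on the number of elements: the complement of a nonzero cyclic subspace is smaller.
\<close>

lemma (in endomorphism) clean_on_invariant_subspace:
  assumes card: "CARD('a) \<ge> 4" and two: "(2::'a) \<noteq> 0"
    and power: "\<And>c :: 'a. c \<noteq> 0 \<Longrightarrow> c ^ m = 1"
    and S: "finite S" "subspace S" "\<And>x. x \<in> S \<Longrightarrow> T x \<in> S"
  shows "clean_on m S"
  using S
proof (induction "card S" arbitrary: S rule: less_induct)
  case less
  interpret finite_invariant_subspace scale T S
    using less.prems by unfold_locales auto
  obtain v where v: "v \<in> S" and max: "\<And>p w. poly_action p v = 0 \<Longrightarrow> w \<in> S \<Longrightarrow> poly_action p w = 0"
    using vector_with_minimal_annihilator by blast
  show ?case
  proof (cases "v = 0")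
    case True
    then have "S \<subseteq> {0}" using max[of 1] by auto
    interpret u: Vector_Spaces.linear scale scale "(\<lambda>y. T y - y) ^^ m"
      by (intro linear_funpow linear_T_diff linear_ident)
    show ?thesis
      unfolding clean_on_def using \<open>S \<subseteq> {0}\<close> linear_ident
      by (intro exI[of _ "\<lambda>x. x"]) auto
  next
    case False
    obtain n where ind: "\<And>k. k \<le> n \<Longrightarrow> (T ^^ k) v \<notin> krylov v k"
      and dep: "(T ^^ Suc n) v \<in> krylov v (Suc n)"
      by (rule krylov_stabilises[OF v False]) (assumption | rule that)+
    obtain W' where W': "subspace W'" "W' \<subseteq> S" "\<And>x. x \<in> W' \<Longrightarrow> T x \<in> W'"
      and inter: "krylov v (Suc n) \<inter> W' \<subseteq> {0}"
      and sum: "S = {x + y | x y. x \<in> krylov v (Suc n) \<and> y \<in> W'}"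
      by (rule krylov_complement[OF v max ind dep]) (assumption | rule that)+
    have "v \<in> krylov v (Suc n)"
      using krylov_base[of 0 "Suc n" v] by simp
    then have "v \<notin> W'"
      using inter False by auto
    then have "card W' < card S"
      using v W'(2) finite_S by (intro psubset_card_mono) auto
    then have clean_W': "clean_on m W'"
      using W' finite_S by (intro less.hyps) (auto intro: finite_subset)
    obtain \<tau> where \<tau>: "(T ^^ Suc n) v - \<tau> *s (T ^^ n) v \<in> krylov v n"
      using dep krylov_Suc by blast
    obtain \<epsilon> \<mu> :: "nat \<Rightarrow> 'a" where
      eps: "\<forall>j\<le>n. \<epsilon> j = 0 \<or> \<epsilon> j = 1" "\<forall>j<n. \<epsilon> j + \<epsilon> (Suc j) = 1" and
      mu: "\<forall>j\<le>n. \<mu> j \<noteq> 0" "\<forall>j<n. \<mu> j \<noteq> \<mu> (Suc j)" "\<forall>j<n. \<mu> (Suc j) \<noteq> \<mu> 0" and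
      trace: "(\<Sum>j\<le>n. \<epsilon> j + \<mu> j) = \<tau>"
      using diagonal_choice[OF card two, of n \<tau>] by blast
    have "clean_on m (krylov v (Suc n))"
    proof (rule clean_on_cyclic[of m n v \<tau> "\<lambda>i. \<epsilon> (n - i)" "\<lambda>i. \<mu> (n - i)"])
      show "(\<Sum>i\<le>n. \<epsilon> (n - i) + \<mu> (n - i)) = \<tau>"
        using trace sum.nat_diff_reindex[of "\<lambda>j. \<epsilon> j + \<mu> j" "Suc n"]
        by (simp add: lessThan_Suc_atMost)
      fix i assume "i < n"
      then have j: "n - Suc i < n" "n - i = Suc (n - Suc i)" by simp_all
      show "\<epsilon> (n - i) + \<epsilon> (n - Suc i) = 1"
        using eps(2) j by (simp add: add.commute)
      show "\<mu> (n - i) \<noteq> \<mu> (n - Suc i)"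
        using mu(2) j by (metis (no_types))
      show "\<mu> (n - i) \<noteq> \<mu> (n - n)"
        using mu(3) j by simp
    next
      fix i assume "i \<le> n"
      show "\<epsilon> (n - i) = 0 \<or> \<epsilon> (n - i) = 1" "\<mu> (n - i) \<noteq> 0"
        using eps(1) mu(1) by simp_all
    qed (fact power ind \<tau>)+
    from clean_on_direct_sum[OF subspace_krylov _ this W'(1) _ clean_W' inter sum]
    show ?thesis
      using T_krylov_invariant[OF dep] W'(3) by blast
  qed
qed

section \<open>Matrices over finite fields\<close>

text \<open>
  Vectors of all lengths \<open>n\<close> are modelled inside one type, as the functions that vanish from \<open>n\<close> on,
  so that the results on endomorphisms apply.
\<close>

interpretation fun_vs: vector_space "\<lambda>c (f :: nat \<Rightarrow> 'a::field) i. c * f i"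
  by unfold_locales (auto simp: fun_eq_iff algebra_simps)

lemma sum_fun_apply: "(\<Sum>k\<in>K. f k) i = (\<Sum>k\<in>K. f k i)"
  by (induction K rule: infinite_finite_induct) simp_all

text \<open>
  Multiplication by \<open>x\<close> permutes the nonzero elements and so leaves their product unchanged.
\<close>

lemma exponent_card_minus_one:
  fixes x :: "'a::idom"
  assumes "finite (UNIV :: 'a set)" "x \<noteq> 0"
  shows "x ^ (CARD('a) - 1) = 1"
proof -
  have "(*) x ` (UNIV - {0}) = UNIV - {0}"
    using assms by (intro card_subset_eq) (auto simp: card_image inj_on_def)
  then have "\<Prod>(UNIV - {0}) = prod ((*) x) (UNIV - {0})"
    using assms prod.reindex[of "(*) x" "UNIV - {0}" "\<lambda>y. y"] by (simp add: inj_on_def)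
  also have "\<dots> = x ^ (CARD('a) - 1) * \<Prod>(UNIV - {0})"
    using assms by (simp add: prod.distrib card_Diff_singleton)
  finally show ?thesis
    using assms by simp
qed

lemma field_matrix_clean:
  fixes A :: "'a::field mat"
  assumes A: "A \<in> carrier_mat n n" and card: "CARD('a) \<ge> 4" and two: "(2::'a) \<noteq> 0"
  obtains E U where "E \<in> carrier_mat n n" "U \<in> carrier_mat n n"
    "E * E = E" "U ^\<^sub>m (CARD('a) - 1) = 1\<^sub>m n" "A = E + U"
proof -
  let ?s = "\<lambda>c (f :: nat \<Rightarrow> 'a) i. c * f i"
  define m where "m = CARD('a) - 1"
  have fin: "finite (UNIV :: 'a set)"
    using card by (metis card.infinite not_numeral_le_zero)
  define S where "S = {f :: nat \<Rightarrow> 'a. \<forall>i\<ge>n. f i = 0}"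
  define T where "T f = (\<lambda>i. if i < n then \<Sum>j<n. A $$ (i, j) * f j else 0)" for f
  interpret endomorphism ?s T
  proof (intro endomorphism.intro endomorphism_axioms.intro)
    show "Vector_Spaces.linear ?s ?s T"
      by (auto simp: Vector_Spaces.linear_iff fun_vs.vector_space_axioms T_def fun_eq_iff
          sum.distrib distrib_left sum_distrib_left mult.left_commute)
  qed (rule fun_vs.vector_space_axioms)
  have "finite S"
  proof (rule finite_subset)
    show "S \<subseteq> (\<lambda>g i. if i < n then g i else 0) ` (PiE {..<n} (\<lambda>_. UNIV))"
    proof
      fix f assume "f \<in> S"
      then have "f = (\<lambda>i. if i < n then restrict f {..<n} i else 0)"
        by (auto simp: S_def fun_eq_iff)
      moreover have "restrict f {..<n} \<in> PiE {..<n} (\<lambda>_. UNIV)"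
        by auto
      ultimately show "f \<in> (\<lambda>g i. if i < n then g i else 0) ` (PiE {..<n} (\<lambda>_. UNIV))"
        by (rule image_eqI)
    qed
    show "finite ((\<lambda>g i. if i < n then g i else (0::'a)) ` (PiE {..<n} (\<lambda>_. UNIV)))"
      by (intro finite_imageI finite_PiE fin) auto
  qed
  moreover have S: "fun_vs.subspace S"
    by (auto simp: fun_vs.subspace_def S_def)
  moreover have T_S: "T f \<in> S" for f
    by (auto simp: S_def T_def)
  ultimately have "clean_on m S"
    using exponent_card_minus_one[OF fin] by (intro clean_on_invariant_subspace[OF card two]) (auto simp: m_def)
  then obtain e where e: "Vector_Spaces.linear ?s ?s e"
    and e_S: "\<And>x. x \<in> S \<Longrightarrow> e x \<in> S" "\<And>x. x \<in> S \<Longrightarrow> e (e x) = e x"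
    and u: "\<And>x. x \<in> S \<Longrightarrow> ((\<lambda>y. T y - e y) ^^ m) x = x"
    unfolding clean_on_def by blast
  define \<delta> where "\<delta> j i = (if i = j then 1 else 0 :: 'a)" for i j :: nat
  have \<delta>: "\<delta> j \<in> S" if "j < n" for j
    using that by (auto simp: S_def \<delta>_def)
  \<comment> \<open>The matrix of \<open>f\<close> with respect to the unit vectors \<open>\<delta> j\<close>; \<open>T\<close> was defined so that \<open>M T = A\<close>.\<close>
  define M where "M f = mat n n (\<lambda>(i, j). f (\<delta> j) i)" for f :: "(nat \<Rightarrow> 'a) \<Rightarrow> nat \<Rightarrow> 'a"
  have M_mult: "M f * M g = M (f \<circ> g)"
    if f: "Vector_Spaces.linear ?s ?s f" and g: "\<And>x. x \<in> S \<Longrightarrow> g x \<in> S" for f g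
  proof (rule eq_matI)
    fix i j assume "i < dim_row (M (f \<circ> g))" "j < dim_col (M (f \<circ> g))"
    then have ij: "i < n" "j < n" by (auto simp: M_def)
    interpret f: Vector_Spaces.linear ?s ?s f by fact
    have "x = (\<Sum>k<n. (\<lambda>i. x k * \<delta> k i))" if "x \<in> S" for x
      using that by (auto simp: S_def \<delta>_def fun_eq_iff sum_fun_apply if_distrib cong: if_cong)
    then have "g (\<delta> j) = (\<Sum>k<n. (\<lambda>i. g (\<delta> j) k * \<delta> k i))"
      using g \<delta> ij by blast
    then have "f (g (\<delta> j)) i = (\<Sum>k<n. f (\<lambda>i. g (\<delta> j) k * \<delta> k i)) i"
      by (metis f.sum)
    also have "\<dots> = (\<Sum>k<n. g (\<delta> j) k * f (\<delta> k) i)"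
      by (simp add: sum_fun_apply f.scale)
    finally show "(M f * M g) $$ (i, j) = M (f \<circ> g) $$ (i, j)"
      using ij by (auto simp: M_def scalar_prod_def lessThan_atLeast0 mult.commute)
  qed (auto simp: M_def)
  define v where "v y = T y - e y" for y
  have lin_v: "Vector_Spaces.linear ?s ?s v"
    unfolding v_def by (rule linear_T_diff[OF e])
  have v_S: "x \<in> S \<Longrightarrow> v x \<in> S" for x
    using S T_S e_S by (auto simp: v_def intro: fun_vs.subspace_diff)
  have M_v: "M v ^\<^sub>m k = M (v ^^ k)" for k
  proof (induction k)
    case 0
    then show ?case by (auto simp: M_def \<delta>_def one_mat_def intro!: eq_matI)
  next
    case (Suc k)
    have "M (v ^^ k) * M v = M ((v ^^ k) \<circ> v)"
      by (rule M_mult) (auto intro: v_S fun_vs.linear_funpow lin_v)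
    then show ?case using Suc by (simp add: funpow_Suc_right o_def del: funpow.simps)
  qed
  show thesis
  proof (rule that[of "M e" "M v"])
    show "M e * M e = M e"
      using M_mult[OF e, of e] e_S \<delta> by (auto simp: M_def intro!: eq_matI)
    have "M (v ^^ m) = M id"
      using u \<delta> by (auto simp: M_def v_def[abs_def] intro!: eq_matI)
    then show "M v ^\<^sub>m (CARD('a) - 1) = 1\<^sub>m n"
      using M_v[of m] M_v[of 0] by (simp add: m_def id_def) (auto simp: M_def)
    have "T (\<delta> j) i = A $$ (i, j)" if "i < n" "j < n" for i j
      using that by (simp add: T_def \<delta>_def if_distrib cong: if_cong)
    then show "A = M e + M v"
      using A by (auto simp: M_def v_def intro!: eq_matI)
  qed (auto simp: M_def)
qed

section \<open>Finite integral rings\<close>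

lemma two_nonzero:
  assumes "CHAR('a::idom) \<noteq> 2"
  shows "(2::'a) \<noteq> 0"
proof
  assume "(2::'a) = 0"
  then have "CHAR('a) dvd 2"
    using of_nat_eq_0_iff_char_dvd[of 2, where 'a = 'a] by simp
  then show False
    using assms CHAR_not_1[where 'a = 'a] by (metis One_nat_def prime_nat_iff two_is_prime_nat)
qed

lemma finite_idom_field:
  assumes "finite (UNIV :: 'a::idom set)"
  shows "Ring.field (class_ring :: 'a ring)"
proof (rule class_cring.cring_fieldI2)
  fix a :: 'a assume "a \<noteq> 0"
  then have "inj ((*) a)" by (auto simp: inj_def)
  then have "surj ((*) a)" by (rule finite_UNIV_inj_surj[OF assms])
  then show "\<exists>b\<in>UNIV. a * b = 1" by (metis UNIV_I surjD)
qed auto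

text \<open>
  The elements \<open>0\<close>, \<open>1\<close>, \<open>-1\<close> are distinct; if there were no others, then \<open>1 + 1 = -1\<close>, and
  the ring would be the field with three elements.
\<close>

lemma idom_card_ge_4:
  assumes fin: "finite (UNIV :: 'a::idom set)" and two: "(2::'a) \<noteq> 0"
    and not_F3: "\<not> is_ring_iso (class_ring :: 'a ring) (residue_ring 3)"
  shows "CARD('a) \<ge> 4"
proof (rule ccontr)
  assume small: "\<not> CARD('a) \<ge> 4"
  have neg1: "(1::'a) \<noteq> - 1"
    using two by (metis eq_neg_iff_add_eq_0 one_add_one)
  then have "card {0, 1, - 1 :: 'a} = 3" by simp
  then have univ: "UNIV = {0, 1, - 1 :: 'a}"
    using small fin by (intro card_seteq[symmetric]) auto
  have "(1 + 1 :: 'a) \<in> {0, 1, - 1}"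
    using univ by blast
  then have sum: "(1 + 1 :: 'a) = - 1"
    using two by (metis add_cancel_left_left empty_iff insert_iff one_add_one zero_neq_one)
  then have two_eq: "(2::'a) = - 1" "- (2::'a) = 1"
    by simp_all
  define f :: "'a \<Rightarrow> int" where "f x = (if x = 0 then 0 else if x = 1 then 1 else 2)" for x
  have f: "f 0 = 0" "f 1 = 1" "f (- 1) = 2"
    using neg1 by (auto simp: f_def)
  have f_two: "f 2 = 2" "f (- 2) = 1"
    by (simp_all only: two_eq(1) f) (simp only: two_eq(2)[unfolded two_eq(1)] f)
  have elem: "x \<in> {0, 1, - 1}" for x :: 'a
    using univ by blast
  have "f \<in> Ring.ring_hom class_ring (residue_ring 3)"
  proof (rule ring_hom_memI)
    fix x y :: 'a
    show "f x \<in> carrier (residue_ring 3)"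
      by (simp add: f_def residue_ring_def)
    show "f (x \<otimes>\<^bsub>class_ring\<^esub> y) = f x \<otimes>\<^bsub>residue_ring 3\<^esub> f y"
      using elem[of x] elem[of y] by (auto simp: residue_ring_def f)
    show "f (x \<oplus>\<^bsub>class_ring\<^esub> y) = f x \<oplus>\<^bsub>residue_ring 3\<^esub> f y"
      using elem[of x] elem[of y] by (auto simp: residue_ring_def f f_two)
  qed (simp add: f residue_ring_def)
  moreover have "bij_betw f UNIV {0..2}"
  proof (rule bij_betwI')
    show "f x = f y \<longleftrightarrow> x = y" for x y
      using elem[of x] elem[of y] f by auto
    fix k :: int assume "k \<in> {0..2}"
    then have "k = 0 \<or> k = 1 \<or> k = 2" by auto
    then show "\<exists>x\<in>UNIV. k = f x"
      using f by auto
  qed (auto simp: f_def)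
  ultimately have "f \<in> ring_iso class_ring (residue_ring 3)"
    by (simp add: ring_iso_def residue_ring_def)
  then show False
    using not_F3 by (auto simp: is_ring_iso_def)
qed

section \<open>The exponent bounds the order of the ring\<close>

lemma smult_mat_smult_mat: "a \<cdot>\<^sub>m (b \<cdot>\<^sub>m A) = (a * b :: 'a::semigroup_mult) \<cdot>\<^sub>m A"
  by (rule eq_matI) (simp_all add: mult.assoc)

text \<open>
  From \<open>e (e + u) = r e\<close> one gets \<open>e u = (r - 1) e\<close>, so \<open>e = e u\<^sup>k = (r - 1)\<^sup>k e\<close>. A nonzero
  entry of \<open>e\<close> can be cancelled; if there is none, then \<open>u = r I\<close>.
\<close>

lemma scalar_matrix_clean:
  fixes r :: "'a::idom"
  assumes clean: "all_torsion_clean (ring_mat TYPE('a) n ()) k" and n: "n \<ge> 1"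
  shows "r ^ k = 1 \<or> (r - 1) ^ k = 1"
proof -
  let ?R = "ring_mat TYPE('a) n ()"
  interpret ring ?R by (rule ring_mat)
  have "r \<cdot>\<^sub>m 1\<^sub>m n \<in> carrier ?R" by (simp add: ring_mat_simps)
  then obtain e u where "torsion_clean_decomposition ?R k (r \<cdot>\<^sub>m 1\<^sub>m n) e u"
    using clean unfolding all_torsion_clean_def by blast
  then have e: "e \<in> carrier_mat n n" and "u \<in> Units ?R" and "e [^]\<^bsub>?R\<^esub> (2::nat) = e"
    and "u [^]\<^bsub>?R\<^esub> k = \<one>\<^bsub>?R\<^esub>" and sum: "r \<cdot>\<^sub>m 1\<^sub>m n = e + u"
    by (auto simp: torsion_clean_decomposition_def ring_mat_simps)
  moreover from this have u: "u \<in> carrier_mat n n"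
    using Units_closed[of u] by (simp add: ring_mat_simps)
  ultimately have idem: "e * e = e" and power: "u ^\<^sub>m k = 1\<^sub>m n"
    using pow_mat_ring_pow[OF e, of 2 "()"] pow_mat_ring_pow[OF u, of k "()"]
    by (simp_all add: ring_mat_simps numeral_2_eq_2)
  have "e * (e + u) = r \<cdot>\<^sub>m e"
    unfolding sum[symmetric] using e by (simp add: mult_smult_distrib[OF e one_carrier_mat])
  then have eu: "e + e * u = r \<cdot>\<^sub>m e"
    using e u idem by (simp add: mult_add_distrib_mat)
  have eu: "e * u = (r - 1) \<cdot>\<^sub>m e"
  proof (rule eq_matI)
    fix i j assume "i < dim_row ((r - 1) \<cdot>\<^sub>m e)" "j < dim_col ((r - 1) \<cdot>\<^sub>m e)"
    then have ij: "i < n" "j < n" using e by auto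
    have "(e + e * u) $$ (i, j) = (r \<cdot>\<^sub>m e) $$ (i, j)" using eu by simp
    then show "(e * u) $$ (i, j) = ((r - 1) \<cdot>\<^sub>m e) $$ (i, j)"
      using e u ij by (simp add: algebra_simps del: index_mult_mat(1))
  qed (use e u in auto)
  have "e * (u ^\<^sub>m i) = (r - 1) ^ i \<cdot>\<^sub>m e" for i
  proof (induction i)
    case (Suc i)
    have "e * u ^\<^sub>m Suc i = (e * u ^\<^sub>m i) * u"
      using e u by (simp add: assoc_mult_mat[of _ n n _ n _ n])
    also have "\<dots> = (r - 1) ^ Suc i \<cdot>\<^sub>m e"
      using e u Suc eu by (simp add: mult_smult_assoc_mat[of _ n n _ n] smult_mat_smult_mat mult.commute)
    finally show ?case .
  qed (use e u in auto)
  from this[of k] have e_eq: "(r - 1) ^ k \<cdot>\<^sub>m e = e"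
    using power e by simp
  show ?thesis
  proof (cases "e = 0\<^sub>m n n")
    case True
    then have "u = r \<cdot>\<^sub>m 1\<^sub>m n" using sum u by simp
    moreover have "(r \<cdot>\<^sub>m 1\<^sub>m n) ^\<^sub>m i = r ^ i \<cdot>\<^sub>m 1\<^sub>m n" for i
      by (induction i) (auto simp: mult_smult_assoc_mat[of _ n n _ n] mult_smult_distrib[of _ n n _ n] smult_mat_smult_mat mult.commute)
    ultimately have "(r ^ k \<cdot>\<^sub>m 1\<^sub>m n) $$ (0, 0) = (1\<^sub>m n :: 'a mat) $$ (0, 0)"
      using power by simp
    then show ?thesis using n by simp
  next
    case False
    then obtain i j where "i < n" "j < n" "e $$ (i, j) \<noteq> 0"
      using e by (metis (no_types, lifting) carrier_matD eq_matI index_zero_mat)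
    moreover have "((r - 1) ^ k \<cdot>\<^sub>m e) $$ (i, j) = e $$ (i, j)"
      using e_eq by simp
    ultimately show ?thesis using e by auto
  qed
qed

text \<open>
  The set \<open>G\<close> of \<open>k\<close>-th roots of unity and its translate \<open>1 + G\<close> cover the ring. A nonzero \<open>x\<close> outside \<open>G\<close>
  would give a coset \<open>x G\<close> disjoint from \<open>G\<close>, hence \<open>2 |G|\<close> nonzero
  elements, although the whole ring has at most \<open>2 |G|\<close> elements.
\<close>

lemma torsion_exponent_bound:
  fixes k :: nat
  assumes "k > 0" and *: "\<And>r :: 'a::idom. r ^ k = 1 \<or> (r - 1) ^ k = 1"
  shows "finite (UNIV :: 'a set) \<and> CARD('a) - 1 \<le> k"
proof -
  define G where "G = {r :: 'a. r ^ k = 1}"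
  have monom: "degree (Polynomial.monom (1::'a) k - 1) \<le> k" "Polynomial.monom (1::'a) k - 1 \<noteq> 0"
    using \<open>k > 0\<close> by (auto simp: degree_diff_le degree_monom_le monom_eq_1_iff)
  have G_roots: "G = {r. poly (Polynomial.monom 1 k - 1) r = 0}"
    by (auto simp: G_def poly_monom)
  have fin_G: "finite G"
    unfolding G_roots using monom by (intro poly_roots_finite)
  have "card G \<le> k"
    unfolding G_roots using card_poly_roots_bound[OF monom(2)] monom(1) by linarith
  have UNIV: "UNIV = G \<union> (+) 1 ` G"
  proof -
    have "r \<in> G \<union> (+) 1 ` G" for r :: 'a
      using *[of r] by (auto simp: G_def image_iff intro: exI[of _ "r - 1"])
    then show ?thesis by auto
  qed
  then have fin: "finite (UNIV :: 'a set)"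
    using fin_G by (metis finite_Un finite_imageI)
  have "CARD('a) \<le> card G + card ((+) 1 ` G)"
    by (subst UNIV) (rule card_Un_le)
  then have card_le: "CARD('a) \<le> 2 * card G"
    using card_image_le[OF fin_G, of "(+) 1"] by linarith
  have "UNIV - {0} \<subseteq> G"
  proof
    fix x :: 'a assume x: "x \<in> UNIV - {0}"
    show "x \<in> G"
    proof (rule ccontr)
      assume "x \<notin> G"
      then have "G \<inter> (*) x ` G = {}"
        by (auto simp: G_def power_mult_distrib)
      then have "card (G \<union> (*) x ` G) = 2 * card G"
        using fin_G x by (simp add: card_Un_disjoint card_image inj_on_def)
      moreover have "G \<union> (*) x ` G \<subseteq> UNIV - {0}"
        using x \<open>k > 0\<close> by (auto simp: G_def power_0_left)
      then have "card (G \<union> (*) x ` G) \<le> CARD('a) - 1"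
        using card_mono[of "UNIV - {0::'a}" "G \<union> (*) x ` G"] fin by (simp add: card_Diff_singleton)
      moreover have "CARD('a) > 0"
        using fin by (simp add: card_gt_0_iff)
      ultimately show False using card_le by linarith
    qed
  qed
  then have "CARD('a) - 1 \<le> card G"
    using card_mono[OF fin_G, of "UNIV - {0}"] by (simp add: card_Diff_singleton)
  with \<open>card G \<le> k\<close> fin show ?thesis by simp
qed

section \<open>Matrices over finite integral rings\<close>

text \<open>
  Through this bijection the result on matrices over the field of fractions carries over to matrices over
  a finite integral ring.
\<close>

lemma finite_idom_to_fract:
  assumes "finite (UNIV :: 'a::idom set)"
  shows "bij (to_fract :: 'a \<Rightarrow> 'a fract)"
proof (rule bijI)
  show "inj (to_fract :: 'a \<Rightarrow> 'a fract)"
    by (simp add: inj_def)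
  have "z \<in> range to_fract" for z :: "'a fract"
  proof (cases z)
    case (Fract a b)
    then have "inj ((*) b)" by (simp add: inj_def)
    then have "surj ((*) b)" by (rule finite_UNIV_inj_surj[OF assms])
    then obtain c where "a = b * c" by (metis surjD)
    then have "z = to_fract c"
      using Fract by (simp add: Fract_conv_to_fract)
    then show ?thesis by blast
  qed
  then show "surj (to_fract :: 'a \<Rightarrow> 'a fract)" by blast
qed

lemma matrix_all_torsion_clean:
  assumes fin: "finite (UNIV :: 'a::idom set)" and card: "CARD('a) \<ge> 4" and two: "(2::'a) \<noteq> 0"
  shows "all_torsion_clean (ring_mat TYPE('a) n ()) (CARD('a) - 1)"
  unfolding all_torsion_clean_def
proof
  let ?R = "ring_mat TYPE('a) n ()"
  let ?m = "CARD('a) - 1"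
  let ?h = "map_mat (to_fract :: 'a \<Rightarrow> 'a fract)"
  let ?g = "map_mat (inv_into UNIV to_fract :: 'a fract \<Rightarrow> 'a)"
  interpret ring ?R by (rule ring_mat)
  fix A assume "A \<in> carrier ?R"
  then have A: "A \<in> carrier_mat n n" by (simp add: ring_mat_simps)
  have bij: "bij (to_fract :: 'a \<Rightarrow> 'a fract)"
    by (rule finite_idom_to_fract[OF fin])
  have hg: "?h (?g B) = B" for B
    using bij by (intro eq_matI) (auto simp: bij_is_surj surj_f_inv_f)
  have card': "CARD('a fract) = CARD('a)"
    using bij_betw_same_card[OF bij] by simp
  have "(2 :: 'a fract) \<noteq> 0"
    using two by (metis to_fract_1 to_fract_add to_fract_eq_0_iff one_add_one)
  then obtain E U where EU: "E \<in> carrier_mat n n" "U \<in> carrier_mat n n"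
    "E * E = E" "U ^\<^sub>m ?m = 1\<^sub>m n" "?h A = E + U"
    using field_matrix_clean[of "?h A" n] A card unfolding card' by auto
  define e where "e = ?g E"
  define u where "u = ?g U"
  have eu: "e \<in> carrier_mat n n" "u \<in> carrier_mat n n" "?h e = E" "?h u = U"
    using EU by (auto simp: e_def u_def hg)
  have "?h (e * e) = ?h e"
    using eu EU by (simp add: to_fract_hom.mat_hom_mult[of _ n n _ n])
  then have "e * e = e" by (rule to_fract_hom.mat_hom_inj)
  then have idem: "e [^]\<^bsub>?R\<^esub> (2::nat) = e"
    using pow_mat_ring_pow[OF eu(1), of 2 "()"] eu by (simp add: numeral_2_eq_2)
  have "?h (u ^\<^sub>m ?m) = ?h (1\<^sub>m n)"
    using eu EU by (simp only: to_fract_hom.mat_hom_pow[of _ n] to_fract_hom.mat_hom_one)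
  then have "u ^\<^sub>m ?m = 1\<^sub>m n" by (rule to_fract_hom.mat_hom_inj)
  then have power: "u [^]\<^bsub>?R\<^esub> ?m = \<one>\<^bsub>?R\<^esub>"
    using pow_mat_ring_pow[OF eu(2), of ?m "()"] by (simp add: ring_mat_simps)
  have carrier: "u \<in> carrier ?R" using eu by (simp add: ring_mat_simps)
  obtain k where k: "?m = Suc k"
    using card by (cases ?m) auto
  have "u [^]\<^bsub>?R\<^esub> k \<otimes>\<^bsub>?R\<^esub> u = \<one>\<^bsub>?R\<^esub>" "u \<otimes>\<^bsub>?R\<^esub> u [^]\<^bsub>?R\<^esub> k = \<one>\<^bsub>?R\<^esub>"
    using power unfolding k nat_pow_Suc2[OF carrier, symmetric] nat_pow_Suc[symmetric] by (simp_all only:)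
  then have "u \<in> Units ?R"
    using carrier nat_pow_closed[OF carrier, of k] unfolding Units_def by blast
  moreover have "A = e + u"
  proof (rule to_fract_hom.mat_hom_inj)
    show "?h A = ?h (e + u)"
      using eu EU by (auto intro!: eq_matI)
  qed
  ultimately show "\<exists>e u. torsion_clean_decomposition ?R ?m A e u"
    using eu idem power unfolding torsion_clean_decomposition_def ring_mat_simps by blast
qed

section \<open>The least exponent of a matrix ring\<close>

theorem theorem1p5:
  fixes q :: nat
  assumes "q > 1" and "odd q"
    and "\<not> is_ring_iso (class_ring :: 'a::idom ring) (residue_ring 3)"
    and "CHAR('a) \<noteq> 2"
  shows "((\<forall>n\<ge>1. torsion_clean (ring_mat TYPE('a) n ()) (q - 1)) \<longleftrightarrow>
            Ring.field (class_ring :: 'a ring) \<and> finite (UNIV :: 'a set) \<and> CARD('a) = q) \<and>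
         ((\<exists>n\<ge>1. torsion_clean (ring_mat TYPE('a) n ()) (q - 1)) \<longleftrightarrow>
            Ring.field (class_ring :: 'a ring) \<and> finite (UNIV :: 'a set) \<and> CARD('a) = q)"
    (is "(?all \<longleftrightarrow> ?F) \<and> (?some \<longleftrightarrow> ?F)")
proof -
  have two: "(2::'a) \<noteq> 0"
    by (rule two_nonzero[OF assms(4)])
  have bound: "finite (UNIV :: 'a set) \<and> CARD('a) - 1 \<le> k"
    if "n \<ge> 1" "k > 0" "all_torsion_clean (ring_mat TYPE('a) n ()) k" for n k
    using torsion_exponent_bound[OF that(2)] scalar_matrix_clean[OF that(3,1)] by blast
  have attained: "all_torsion_clean (ring_mat TYPE('a) n ()) (CARD('a) - 1)"
    if "finite (UNIV :: 'a set)" for n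
    using that idom_card_ge_4[OF that two assms(3)] two by (rule matrix_all_torsion_clean)
  have "?F \<Longrightarrow> ?all"
    using attained bound assms(1) unfolding torsion_clean_def by auto
  moreover have "?all \<Longrightarrow> ?some"
    by blast
  moreover have "?some \<Longrightarrow> ?F"
  proof -
    assume ?some
    then obtain n where n: "n \<ge> 1" and clean: "all_torsion_clean (ring_mat TYPE('a) n ()) (q - 1)"
      and least: "\<And>k. k > 0 \<Longrightarrow> all_torsion_clean (ring_mat TYPE('a) n ()) k \<Longrightarrow> q - 1 \<le> k"
      unfolding torsion_clean_def by blast
    have fin: "finite (UNIV :: 'a set)" and le: "CARD('a) - 1 \<le> q - 1"
      using bound[OF n _ clean] assms(1) by auto
    have "CARD('a) \<ge> 4"
      by (rule idom_card_ge_4[OF fin two assms(3)])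
    then have "q - 1 \<le> CARD('a) - 1"
      using attained[OF fin] by (intro least) auto
    then have "CARD('a) = q"
      using le assms(1) \<open>CARD('a) \<ge> 4\<close> by linarith
    then show ?F
      using finite_idom_field[OF fin] fin by blast
  qed
  ultimately show ?thesis by blast
qed

end
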